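(* For every fixed positive integer $n$, the sequence $\mathrm{BoNa}(n,1),\mathrm{BoNa}(n,2),\ldots,\mathrm{BoNa}(n,n)$ is unimodal.
   Context: A binary plane tree is a rooted plane tree on unlabeled vertices in which every non-leaf vertex has one or two children, and every child is a left child or a right child, even if it is the only child of its parent. A 0-1-tree is a binary plane tree in which every vertex that has two children is labeled 0 or 1 (no other vertex is labeled). A right edge is an edge connecting a vertex to its right child. For $n\ge 1$, the Boolean-Narayana number $\mathrm{BoNa}(n,k)$ is the number of 0-1-trees on $n$ vertices that have exactly $k-1$ right edges. A sequence $a_1,\ldots,a_n$ is unimodal if there exists an index $k$ such that $a_1\leq a_2\leq \cdots\leq a_k\geq a_{k+1}\geq\cdots\geq a_n$. *)

theory Defs
  imports "HOL-Library.Tree"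
begin

text \<open>
  The vertices of a binary plane tree are the \<^const>\<open>Node\<close>s of a library tree; \<^const>\<open>Leaf\<close> stands for
  an absent child, not for a leaf vertex. Hence \<open>size t\<close> is the number of vertices.
  A vertex carries \<^const>\<open>None\<close> if it is unlabeled and \<^term>\<open>Some b\<close> if it is labeled, where
  \<^const>\<open>False\<close> and \<^const>\<open>True\<close> encode the labels 0 and 1. Exactly the vertices with two children
  are labeled.
\<close>

fun zero_one_tree :: "bool option tree \<Rightarrow> bool" where
  "zero_one_tree \<langle>\<rangle> = True"
| "zero_one_tree \<langle>l, x, r\<rangle> =
     ((x \<noteq> None \<longleftrightarrow> l \<noteq> \<langle>\<rangle> \<and> r \<noteq> \<langle>\<rangle>) \<and> zero_one_tree l \<and> zero_one_tree r)"

fun right_edges :: "'a tree \<Rightarrow> nat" where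
  "right_edges \<langle>\<rangle> = 0"
| "right_edges \<langle>l, x, r\<rangle> = right_edges l + right_edges r + (if r = \<langle>\<rangle> then 0 else 1)"

text \<open>
  The empty tree \<^const>\<open>Leaf\<close> is not a binary plane tree, but it is counted only for \<open>n = 0\<close>, so
  this is the Boolean-Narayana number for \<open>n \<ge> 1\<close>. The counted sets are finite (lemma below).
\<close>

definition BoNa :: "nat \<Rightarrow> nat \<Rightarrow> nat" where
  "BoNa n k = card {t. zero_one_tree t \<and> size t = n \<and> right_edges t + 1 = k}"

lemma finite_trees_size_le: "finite {t :: 'a::finite tree. size t \<le> n}"
proof (induction n)
  case 0
  then show ?case by simp
next
  case (Suc n)
  let ?T = "{t :: 'a tree. size t \<le> n}"
  have "{t :: 'a tree. size t \<le> Suc n} \<subseteq>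
      insert \<langle>\<rangle> ((\<lambda>(l, x, r). \<langle>l, x, r\<rangle>) ` (?T \<times> (UNIV \<times> ?T)))"
  proof
    fix t :: "'a tree"
    assume "t \<in> {t. size t \<le> Suc n}"
    then show "t \<in> insert \<langle>\<rangle> ((\<lambda>(l, x, r). \<langle>l, x, r\<rangle>) ` (?T \<times> (UNIV \<times> ?T)))"
      by (cases t) force+
  qed
  moreover have "finite (insert \<langle>\<rangle> ((\<lambda>(l, x, r). \<langle>l, x, r\<rangle>) ` (?T \<times> ((UNIV :: 'a set) \<times> ?T))))"
    using Suc by (intro finite.insertI finite_imageI finite_cartesian_product) auto
  ultimately show ?case by (rule finite_subset)
qed

lemma finite_BoNa_trees:
  "finite {t. zero_one_tree t \<and> size t = n \<and> right_edges t + 1 = k}"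
  by (rule finite_subset[OF _ finite_trees_size_le[of n]]) auto

text \<open>Unimodality of the finite sequence \<open>a 1, \<dots>, a n\<close>.\<close>

definition unimodal :: "nat \<Rightarrow> (nat \<Rightarrow> 'a::order) \<Rightarrow> bool" where
  "unimodal n a \<longleftrightarrow>
     (\<exists>k\<in>{1..n}. (\<forall>i\<in>{1..<k}. a i \<le> a (i + 1)) \<and> (\<forall>i\<in>{k..<n}. a i \<ge> a (i + 1)))"

end

theory Submission
  imports Defs "HOL-Computational_Algebra.Polynomial"
begin

text \<open>
  Let \<open>P\<^sub>n(z) = \<Sum>\<^sub>k BoNa(n,k) z\<^bsup>k-1\<^esup>\<close>. Removing the root of a tree gives
  \<open>P\<^sub>n\<^sub>+\<^sub>1 = (1 + z) P\<^sub>n + 2z \<Sum>\<^bsub>i+j=n\<^esub> P\<^sub>i P\<^sub>j\<close>. By induction, \<open>P\<^sub>n\<close> is gamma-positive, that is, a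
  nonnegative combination of the polynomials \<open>z\<^sup>j (1 + z)\<^bsup>n-1-2j\<^esup>\<close>. The coefficients of each of these
  are a shifted row of Pascal's triangle, and all of these rows have the same center \<open>(n - 1)/2\<close>;
  hence the coefficients of \<open>P\<^sub>n\<close> rise up to this center and fall after it.
\<close>

text \<open>The index \<open>d\<close> is twice the common center of symmetry. With coefficients in
  \<open>nat\<close>, closure under addition alone yields all nonnegative combinations.\<close>

inductive gamma_positive :: "nat \<Rightarrow> nat poly \<Rightarrow> bool" where
  zero: "gamma_positive d 0"
| add: "gamma_positive d p \<Longrightarrow> gamma_positive d q \<Longrightarrow> gamma_positive d (p + q)"
| basis: "gamma_positive (2 * j + m) (monom 1 j * [:1, 1:] ^ m)"

lemma gamma_positive_sum:
  "(\<And>x. x \<in> A \<Longrightarrow> gamma_positive d (f x)) \<Longrightarrow> gamma_positive d (\<Sum>x\<in>A. f x)"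
  by (induction A rule: infinite_finite_induct) (auto intro: gamma_positive.intros)

text \<open>Exponents add, so two basis polynomials multiply to a basis polynomial; bilinearity does
  the rest.\<close>

lemma gamma_positive_mult:
  assumes "gamma_positive d p" "gamma_positive e q"
  shows "gamma_positive (d + e) (p * q)"
  using assms
proof (induction rule: gamma_positive.induct)
  case (basis j m)
  then show ?case
  proof (induction rule: gamma_positive.induct)
    case (basis j' m')
    have z: "monom 1 (j + j') = monom (1 :: nat) j * monom 1 j'"
      by (simp add: mult_monom)
    have "monom 1 j * [:1, 1:] ^ m * (monom 1 j' * [:1, 1:] ^ m')
        = monom 1 (j + j') * [:1, 1 :: nat:] ^ (m + m')"
      by (simp only: z power_add mult.assoc mult.commute mult.left_commute)
    then show ?case
      using gamma_positive.basis[of "j + j'" "m + m'"] by (simp add: algebra_simps)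
  qed (auto simp: distrib_left intro: gamma_positive.intros)
qed (auto simp: distrib_right intro: gamma_positive.intros)

lemma coeff_one_plus_X_power: "coeff ([:1, 1 :: nat:] ^ m) i = m choose i"
  by (induction m arbitrary: i) (auto simp: coeff_pCons binomial_eq_0 split: nat.split)

lemma coeff_basis:
  "coeff (monom 1 j * [:1, 1 :: nat:] ^ m) i = (if i < j then 0 else m choose (i - j))"
  by (simp add: coeff_monom_mult coeff_one_plus_X_power del: One_nat_def)

lemma binomial_le_Suc:
  assumes "2 * r + 1 \<le> m"
  shows "m choose r \<le> m choose Suc r"
\<comment> \<open>For odd \<open>m\<close> the two middle entries are equal by symmetry; there
  \<open>Suc r\<close> already lies beyond \<open>m / 2\<close>, out of reach of
  \<open>binomial_mono\<close>.\<close>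
proof (cases "m = 2 * r + 1")
  case True
  then show ?thesis
    using binomial_symmetric[of r m] by simp
next
  case False
  then show ?thesis
    using assms by (intro binomial_mono) auto
qed

lemma binomial_ge_Suc:
  assumes "m \<le> 2 * r + 1"
  shows "m choose Suc r \<le> m choose r"
  using assms by (cases "Suc r \<le> m") (auto intro!: binomial_antimono simp: binomial_eq_0)

lemma gamma_positive_coeff_le:
  assumes "gamma_positive d p" "2 * i + 1 \<le> d"
  shows "coeff p i \<le> coeff p (Suc i)"
  using assms
proof (induction rule: gamma_positive.induct)
  case (basis j m)
  \<comment> \<open>For \<open>i < j\<close> the left side is 0. Otherwise subtracting
    \<open>2 * j\<close> from the bound leaves \<open>2 * (i - j) + 1 \<le> m\<close>.\<close>
  then show ?case
    by (auto simp: coeff_basis Suc_diff_le simp del: One_nat_def intro!: binomial_le_Suc)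
qed (auto intro: add_mono)

lemma gamma_positive_coeff_ge:
  assumes "gamma_positive d p" "d \<le> 2 * i + 1"
  shows "coeff p (Suc i) \<le> coeff p i"
  using assms
proof (induction rule: gamma_positive.induct)
  case (basis j m)
  \<comment> \<open>Here \<open>i < j\<close> is impossible, since it would give
    \<open>2 * i + 1 < 2 * j \<le> d\<close>.\<close>
  then show ?case
    by (auto simp: coeff_basis Suc_diff_le simp del: One_nat_def intro!: binomial_ge_Suc)
qed (auto intro: add_mono)

definition trees01 :: "nat \<Rightarrow> bool option tree set" where
  "trees01 n = {t. zero_one_tree t \<and> size t = n}"

definition BoNa_poly :: "nat \<Rightarrow> nat poly" where
  "BoNa_poly n = (\<Sum>t\<in>trees01 n. monom 1 (right_edges t))"

lemma finite_trees01: "finite (trees01 n)"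
  by (rule finite_subset[OF _ finite_trees_size_le[of n]]) (auto simp: trees01_def)

lemma coeff_BoNa_poly: "coeff (BoNa_poly n) k = BoNa n (Suc k)"
proof -
  have "coeff (BoNa_poly n) k = card {t \<in> trees01 n. right_edges t = k}"
    using finite_trees01[of n]
    by (simp add: BoNa_poly_def coeff_sum sum.If_cases Int_def)
  then show ?thesis
    by (simp add: BoNa_def trees01_def conj_assoc)
qed

lemma trees01_Suc:
  assumes "n > 0"
  shows "trees01 (Suc n) =
      (\<lambda>l. \<langle>l, None, \<langle>\<rangle>\<rangle>) ` trees01 n \<union> (\<lambda>r. \<langle>\<langle>\<rangle>, None, r\<rangle>) ` trees01 n \<union>
      (\<Union>i\<in>{1..<n}. (\<lambda>(b, l, r). \<langle>l, Some b, r\<rangle>) ` (UNIV \<times> trees01 i \<times> trees01 (n - i)))"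
    (is "_ = ?L \<union> ?R \<union> ?LR")
proof (intro equalityI subsetI)
  fix t
  assume t: "t \<in> trees01 (Suc n)"
  then obtain l x r where node: "t = \<langle>l, x, r\<rangle>"
    by (cases t) (auto simp: trees01_def)
  show "t \<in> ?L \<union> ?R \<union> ?LR"
  \<comment> \<open>The label reveals the shape: an unlabeled root lacks a child, a labeled one has
    both.\<close>
  proof (cases x)
    case None
    then show ?thesis
      using t node by (auto simp: trees01_def)
  next
    case (Some b)
    then have "l \<noteq> \<langle>\<rangle>" "r \<noteq> \<langle>\<rangle>"
      using t node by (auto simp: trees01_def)
    then have "size l > 0" "size r > 0"
      by (auto simp del: neq0_conv simp: neq0_conv[symmetric])
    then have "size l \<in> {1..<n}" "(b, l, r) \<in> UNIV \<times> trees01 (size l) \<times> trees01 (n - size l)"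
      using t node Some by (auto simp: trees01_def)
    then have "t \<in> ?LR"
      using node Some by (intro UN_I[of "size l"]) (auto intro!: image_eqI[of _ _ "(b, l, r)"])
    then show ?thesis by blast
  qed
next
  fix t
  assume "t \<in> ?L \<union> ?R \<union> ?LR"
  then show "t \<in> trees01 (Suc n)"
    using assms by (auto simp: trees01_def)
qed

text \<open>A root with only a left child adds no right edge (factor 1), one with only a right child
  adds one (factor z). With two children there is one new right edge and a choice of two labels
  (factor 2z).\<close>

lemma BoNa_poly_Suc:
  assumes "n > 0"
  shows "BoNa_poly (Suc n) = [:1, 1:] * BoNa_poly n
      + (\<Sum>i = 1..<n. monom 2 1 * (BoNa_poly i * BoNa_poly (n - i)))"
proof -
  let ?w = "\<lambda>t :: bool option tree. monom (1::nat) (right_edges t)"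
  let ?L = "(\<lambda>l. \<langle>l, None :: bool option, \<langle>\<rangle>\<rangle>) ` trees01 n"
  let ?R = "(\<lambda>r. \<langle>\<langle>\<rangle>, None :: bool option, r\<rangle>) ` trees01 n"
  let ?B = "\<lambda>i. (\<lambda>(b, l, r). \<langle>l, Some b, r\<rangle>) ` (UNIV \<times> trees01 i \<times> trees01 (n - i))"
  \<comment> \<open>Nonemptiness ensures that the edge to the right subtree counts, and that
    \<open>?L\<close> and \<open>?R\<close> do not share the one-vertex tree.\<close>
  have ne: "t \<noteq> \<langle>\<rangle>" if "t \<in> trees01 i" "i > 0" for t i
    using that by (auto simp: trees01_def)
  have two: "monom 2 1 = 2 * monom (1 :: nat) 1"
    by (simp only: mult_2 add_monom one_add_one)
  have fin: "finite (?B i)" for i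
    by (intro finite_imageI finite_cartesian_product finite_trees01) auto
  have L: "sum ?w ?L = BoNa_poly n"
    by (subst sum.reindex) (auto simp: inj_on_def BoNa_poly_def)
  have R: "sum ?w ?R = monom 1 1 * BoNa_poly n"
    by (subst sum.reindex)
      (auto simp: inj_on_def BoNa_poly_def sum_distrib_left mult_monom ne[OF _ assms] intro!: sum.cong)
  have B: "sum ?w (?B i) = monom 2 1 * (BoNa_poly i * BoNa_poly (n - i))" if "i \<in> {1..<n}" for i
  proof -
    have "sum ?w (?B i) = (\<Sum>(b, l, r)\<in>UNIV \<times> trees01 i \<times> trees01 (n - i). ?w \<langle>l, Some b, r\<rangle>)"
      by (subst sum.reindex) (auto simp: inj_on_def case_prod_unfold)
    also have "\<dots> = (\<Sum>(b, l, r)\<in>(UNIV :: bool set) \<times> trees01 i \<times> trees01 (n - i).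
        monom 1 1 * (?w l * ?w r))"
      using that by (intro sum.cong) (auto simp: mult_monom dest: ne)
    also have "\<dots> = (\<Sum>b\<in>(UNIV :: bool set). monom 1 1 * (BoNa_poly i * BoNa_poly (n - i)))"
      by (simp only: sum.cartesian_product[symmetric] BoNa_poly_def sum_product)
        (simp only: sum_distrib_left)
    also have "\<dots> = monom 2 1 * (BoNa_poly i * BoNa_poly (n - i))"
      by (simp add: two mult.assoc del: One_nat_def)
    finally show ?thesis .
  qed
  have "BoNa_poly (Suc n) = sum ?w (?L \<union> ?R \<union> (\<Union>i\<in>{1..<n}. ?B i))"
    by (simp only: BoNa_poly_def trees01_Suc[OF assms])
  \<comment> \<open>The root label separates the two-child trees from the others; below, the size of
    the left subtree separates the sets \<open>?B i\<close>.\<close>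
  also have "\<dots> = sum ?w (?L \<union> ?R) + sum ?w (\<Union>i\<in>{1..<n}. ?B i)"
    using fin by (intro sum.union_disjoint) (auto simp: finite_trees01)
  also have "sum ?w (?L \<union> ?R) = sum ?w ?L + sum ?w ?R"
    by (intro sum.union_disjoint) (auto simp: finite_trees01 dest: ne[OF _ assms])
  also have "sum ?w (\<Union>i\<in>{1..<n}. ?B i) = (\<Sum>i = 1..<n. sum ?w (?B i))"
    using fin by (intro sum.UNION_disjoint) (auto simp: trees01_def)
  also have "\<dots> = (\<Sum>i = 1..<n. monom 2 1 * (BoNa_poly i * BoNa_poly (n - i)))"
    by (intro sum.cong refl B)
  finally have "BoNa_poly (Suc n) = BoNa_poly n + monom 1 1 * BoNa_poly n
      + (\<Sum>i = 1..<n. monom 2 1 * (BoNa_poly i * BoNa_poly (n - i)))"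
    by (simp only: L R)
  moreover have "[:1, 1:] = 1 + monom (1 :: nat) 1"
    by (simp add: monom_Suc monom_0 one_pCons)
  ultimately show ?thesis
    by (simp only: distrib_right mult_1_left)
qed

lemma BoNa_poly_1: "BoNa_poly (Suc 0) = 1"
proof -
  have "trees01 (Suc 0) = {\<langle>\<langle>\<rangle>, None, \<langle>\<rangle>\<rangle>}"
  proof (intro equalityI subsetI)
    fix t
    assume "t \<in> trees01 (Suc 0)"
    then show "t \<in> {\<langle>\<langle>\<rangle>, None, \<langle>\<rangle>\<rangle>}"
      by (cases t) (auto simp: trees01_def)
  qed (auto simp: trees01_def)
  then show ?thesis
    by (simp add: BoNa_poly_def del: One_nat_def)
qed

text \<open>Both kinds of terms in the recurrence get the same index: \<open>1 + (n - 1)\<close> for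
  the factor 1 + z, and \<open>2 + (i - 1) + (n - i - 1)\<close> for the products with 2z.\<close>

lemma gamma_positive_BoNa_poly: "gamma_positive n (BoNa_poly (Suc n))"
proof (induction n rule: less_induct)
  case (less n)
  show ?case
  proof (cases n)
    case 0
    then show ?thesis
      using gamma_positive.basis[of 0 0] by (simp add: BoNa_poly_1 del: One_nat_def)
  next
    case (Suc m)
    have "gamma_positive 1 [:1, 1:]"
      using gamma_positive.basis[of 0 1] by (simp del: One_nat_def)
    from gamma_positive_mult[OF this less[of m]]
    have "gamma_positive n ([:1, 1:] * BoNa_poly n)"
      using Suc by simp
    moreover have "gamma_positive n (monom 2 1 * (BoNa_poly i * BoNa_poly (n - i)))"
      if i: "i \<in> {1..<n}" for i
    proof -
      \<comment> \<open>2z is the sum of two copies of the basis element with \<open>j = 1\<close>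
        and \<open>m = 0\<close>.\<close>
      have "gamma_positive 2 (monom 2 1)"
        using gamma_positive.add[OF gamma_positive.basis[of 1 0] gamma_positive.basis[of 1 0]]
        by (simp add: add_monom numeral_2_eq_2)
      moreover have "gamma_positive (i - 1) (BoNa_poly i)"
        "gamma_positive (n - i - 1) (BoNa_poly (n - i))"
        using less[of "i - 1"] less[of "n - i - 1"] i by (auto simp: Suc_diff_Suc)
      ultimately have "gamma_positive (2 + (i - 1 + (n - i - 1)))
          (monom 2 1 * (BoNa_poly i * BoNa_poly (n - i)))"
        by (intro gamma_positive_mult)
      moreover have "2 + (i - 1 + (n - i - 1)) = n"
        using i by auto
      ultimately show ?thesis by metis
    qed
    ultimately have "gamma_positive n ([:1, 1:] * BoNa_poly n
        + (\<Sum>i = 1..<n. monom 2 1 * (BoNa_poly i * BoNa_poly (n - i))))"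
      by (intro gamma_positive.add gamma_positive_sum)
    then show ?thesis
      using Suc by (simp only: BoNa_poly_Suc zero_less_Suc)
  qed
qed

theorem theorem4p1:
  fixes n :: nat
  assumes "n \<ge> 1"
  shows "unimodal n (\<lambda>k. BoNa n k)"
proof -
  obtain d where n: "n = Suc d"
    using assms by (cases n) auto
  \<comment> \<open>Entry \<open>i\<close> is coefficient \<open>i - 1\<close>, so the condition
    \<open>2 * (i - 1) + 1 \<le> d\<close> with \<open>d = n - 1\<close> reads
    \<open>2 * i \<le> n\<close>.\<close>
  have rise: "BoNa n i \<le> BoNa n (i + 1)" if "1 \<le> i" "2 * i \<le> n" for i
    using gamma_positive_coeff_le[OF gamma_positive_BoNa_poly[of d], of "i - 1"] that n
    by (simp add: coeff_BoNa_poly)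
  have fall: "BoNa n (i + 1) \<le> BoNa n i" if "1 \<le> i" "n \<le> 2 * i" for i
    using gamma_positive_coeff_ge[OF gamma_positive_BoNa_poly[of d], of "i - 1"] that n
    by (simp add: coeff_BoNa_poly)
  show ?thesis
    unfolding unimodal_def
    \<comment> \<open>Indices below this peak satisfy \<open>2 * i \<le> n\<close>, those from it on
      \<open>n \<le> 2 * i\<close>; it is at most \<open>n\<close> because
      \<open>n \<ge> 1\<close>.\<close>
    using assms by (intro bexI[of _ "n div 2 + 1"]) (auto intro!: rise[simplified] fall[simplified])
qed

end
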